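(* There is no non-trivial cycle consisting of a single run; that is, there is no non-trivial cycle $(t_1,\dots,t_m)$ in which exactly one of the terms $t_1,\dots,t_m$ is even.
   Context: The subprime Fibonacci rule: from positive integers $x,y$ with $s=x+y$, the next term is $s$ if $s$ is prime and $s/p$ if $s$ is composite, where $p$ is the smallest prime factor of $s$. A non-trivial cycle of length $m$ is an $m$-tuple $(t_1,\dots,t_m)$ of positive integers, indices read modulo $m$, such that for every $i$, $t_i$ is obtained from $t_{i-2},t_{i-1}$ by this rule, the $t_i$ are not all equal, and $m$ is the minimal period. A cycle is a cyclic concatenation of runs, where a run is a maximal block of consecutive odd terms together with the single even term following it; the number of runs equals the number of even terms in one period. *)

theory Defs
  imports "HOL-Computational_Algebra.Primes"
begin

(* Intended for positive x and y, so that the sum is at least 2 and is either prime or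
   composite; the division is exact. *)
definition subprime_next :: "nat \<Rightarrow> nat \<Rightarrow> nat" where
  "subprime_next x y =
    (let s = x + y in if prime s then s else s div Min (prime_factors s))"

(* The tuple (t_1, ..., t_m) is the list t of length m, indexed from 0. The last conjunct
   says that m is the minimal period of the m-periodic extension of t. *)
definition nontrivial_cycle :: "nat \<Rightarrow> nat list \<Rightarrow> bool" where
  "nontrivial_cycle m t \<longleftrightarrow>
     m > 0 \<and> length t = m \<and>
     (\<forall>i<m. t ! i > 0) \<and>
     (\<forall>i<m. t ! ((i + 2) mod m) = subprime_next (t ! i) (t ! ((i + 1) mod m))) \<and>
     (\<exists>i<m. \<exists>j<m. t ! i \<noteq> t ! j) \<and>
     (\<forall>d. 0 < d \<and> d < m \<longrightarrow> (\<exists>i<m. t ! ((i + d) mod m) \<noteq> t ! i))"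

end

theory Submission
  imports Defs
begin

text \<open>
  Inside a run the rule averages the two preceding odd terms. If the run is
  \<open>x, y, \<dots>, z, e\<close> with \<open>e\<close> even and \<open>r = e - z\<close>, running the averages backwards gives
  \<open>y = e - r K\<close> and \<open>x = e - r (1 - 2 K)\<close> for an integer \<open>K\<close>. Closing the cycle requires
  \<open>z + e = p x\<close> and \<open>e + x = q y\<close>, where each of \<open>p\<close>, \<open>q\<close> is 1 (prime sum) or at least 3.
  All averages are at most \<open>max x y\<close>, so \<open>p\<close> and \<open>q\<close> are not both at least 3. If one of them
  is 1, eliminating \<open>e\<close> and \<open>r\<close> yields \<open>K (6 - q) = 1\<close> or \<open>K (6 - p) = 1\<close>, so the other is
  5 or 7; the prime sum is then 3 or 5 times a term, which makes that term 1 and the other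
  sum equal to 5 or 7, a prime after all.
\<close>

section \<open>The rule on even and odd sums\<close>

lemma subprime_next_dvd:
  assumes "\<not> prime (a + b)" and "a + b \<ge> 2"
  obtains p where "prime p" "a + b = p * subprime_next a b" "\<And>q. prime q \<Longrightarrow> q dvd a + b \<Longrightarrow> p \<le> q"
proof -
  let ?P = "prime_factors (a + b)"
  obtain q where "prime q" "q dvd a + b"
    using assms(2) prime_factor_nat[of "a + b"] by auto
  moreover have nz: "a + b \<noteq> 0"
    using assms(2) by linarith
  ultimately have "q \<in> ?P"
    using prime_factors_dvd[OF nz] by blast
  hence "?P \<noteq> {}"
    by blast
  hence "Min ?P \<in> ?P"
    by simp
  hence "prime (Min ?P)" "Min ?P dvd a + b"
    using prime_factors_dvd[OF nz] by blast+
  moreover have "Min ?P \<le> q" if "prime q" "q dvd a + b" for q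
    using that prime_factors_dvd[OF nz] by (intro Min_le finite_set_mset) blast
  ultimately show ?thesis
    using that[of "Min ?P"] assms(1) by (auto simp: subprime_next_def Let_def)
qed

text \<open>The sum 2 has to be excluded: it is prime, so two ones are followed by 2 and not by
  their average.\<close>

lemma subprime_next_even_sum:
  assumes "even (a + b)" and "a + b > 2"
  shows "a + b = 2 * subprime_next a b"
proof -
  have "\<not> prime (a + b)"
    using assms prime_odd_nat[of "a + b"] by auto
  then obtain p where "prime p" "a + b = p * subprime_next a b"
    "\<And>q. prime q \<Longrightarrow> q dvd a + b \<Longrightarrow> p \<le> q"
    using subprime_next_dvd assms(2) by (metis less_imp_le)
  moreover from this have "p = 2"
    using assms(1) prime_ge_2_nat[of p] by (metis le_antisym two_is_prime_nat)
  ultimately show ?thesis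
    by simp
qed

text \<open>The factor 1 stands for the prime case, so that both branches of the rule become one
  linear equation. An odd composite sum has an odd least prime factor, whence the bound 3.\<close>

lemma subprime_next_odd_sum:
  assumes "odd (a + b)" and "a + b \<ge> 2"
  obtains p where "a + b = p * subprime_next a b"
    "prime (a + b) \<and> p = 1 \<or> \<not> prime (a + b) \<and> p \<ge> 3"
proof (cases "prime (a + b)")
  case True
  with that[of 1] show ?thesis
    by (simp add: subprime_next_def)
next
  case False
  then obtain p where p: "prime p" "a + b = p * subprime_next a b"
    using subprime_next_dvd assms(2) by metis
  have "p \<noteq> 2"
    using p(2) assms(1) by (metis dvd_triv_left)
  with prime_ge_2_nat[OF p(1)] have "p \<ge> 3"
    by linarith
  with False p(2) that show ?thesis
    by blast
qed

lemma prime_times_eq_1: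
  fixes q y :: nat
  assumes "prime (q * y)" and "q > 1"
  shows "y = 1"
  using assms by (metis nat_neq_iff prime_product)

lemma prime_3_nat: "prime (3::nat)" and prime_5_nat: "prime (5::nat)" and prime_7_nat: "prime (7::nat)"
proof -
  have "{2..<3} = {2 :: nat}" "{2..<5} = {2, 3, 4 :: nat}" "{2..<7} = {2, 3, 4, 5, 6 :: nat}"
    by auto
  thus "prime (3::nat)" "prime (5::nat)" "prime (7::nat)"
    by (simp_all add: prime_nat_iff')
qed

text \<open>The run occupies the indices 0 to \<open>n + 1\<close>, with the even term last. As the
  rule looks back two terms, the two equations in \<open>per\<close> close the cycle.
  \<open>n \<ge> 1\<close> gives two odd terms to average.\<close>

lemma no_single_run:
  fixes u :: "nat \<Rightarrow> nat"
  assumes "n \<ge> 1"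
    and rec: "\<And>i. u (i + 2) = subprime_next (u i) (u (i + 1))"
    and pos: "\<And>i. u i > 0"
    and odd: "\<And>i. i \<le> n \<Longrightarrow> odd (u i)"
    and even: "even (u (n + 1))"
    and per: "u (n + 2) = u 0" "u (n + 3) = u 1"
  shows False
proof -
  have next_1_1: "subprime_next 1 1 = 2"
    by (simp add: subprime_next_def numeral_2_eq_2[symmetric])
  have avg_inner: "u i + u (i + 1) = 2 * u (i + 2)" if "i + 2 \<le> n" for i
  proof -
    \<comment> \<open>Two ones would produce 2, but the next term still lies in the odd
      block.\<close>
    have "u i + u (i + 1) \<noteq> 2"
    proof
      assume "u i + u (i + 1) = 2"
      hence "u i = 1 \<and> u (i + 1) = 1"
        using pos[of i] pos[of "i + 1"] by linarith
      thus False
        using rec[of i] odd[of "i + 2"] that next_1_1 by simp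
    qed
    hence "u i + u (i + 1) > 2"
      using pos[of i] pos[of "i + 1"] by linarith
    thus ?thesis
      using subprime_next_even_sum[of "u i" "u (i + 1)"] rec[of i] odd[of i] odd[of "i + 1"] that
      by simp
  qed
  have avg_last: "u (n - 1) + u n = 2 * u (n + 1)"
  proof -
    have n: "n - 1 + 1 = n" "n - 1 + 2 = n + 1"
      using \<open>n \<ge> 1\<close> by auto
    \<comment> \<open>Here the next term is even, so parity alone does not exclude two ones. For
      \<open>n = 1\<close> the cycle would be 1, 1, 2, but 3 follows. For larger \<open>n\<close>
      the average forces a further 1 before them, so 2 would appear already at index
      \<open>n\<close>.\<close>
    have "u (n - 1) + u n \<noteq> 2"
    proof
      assume "u (n - 1) + u n = 2"
      hence one: "u (n - 1) = 1" "u n = 1"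
        using pos[of "n - 1"] pos[of n] by linarith+
      hence e: "u (n + 1) = 2"
        using rec[of "n - 1"] n next_1_1 by simp
      show False
      proof (cases "n = 1")
        case True
        have "subprime_next 1 2 = 3"
          using prime_3_nat by (simp add: subprime_next_def eval_nat_numeral)
        thus False
          using rec[of n] one e per(1) True by simp
      next
        case False
        define k where "k = n - 2"
        hence k: "n = k + 2"
          using False \<open>n \<ge> 1\<close> by simp
        have "u k = 1"
          using avg_inner[of k] one k by simp
        thus False
          using rec[of k] one k next_1_1 by simp
      qed
    qed
    hence "u (n - 1) + u n > 2"
      using pos[of "n - 1"] pos[of n] by linarith
    thus ?thesis
      using subprime_next_even_sum[of "u (n - 1)" "u n"] rec[of "n - 1"] odd[of "n - 1"] odd[of n] n
      by simp
  qed
  have avg: "u i + u (i + 1) = 2 * u (i + 2)" if "i < n" for i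
  proof (cases "i + 2 \<le> n")
    case False
    with that have "n = i + 1"
      by simp
    with avg_last show ?thesis
      by simp
  qed (rule avg_inner)

  \<comment> \<open>Running the averages backwards\<close>
  define r :: int where "r = int (u (n + 1)) - int (u n)"
  have "r \<noteq> 0"
    using odd[of n] even by (auto simp: r_def)
  \<comment> \<open>Offsets from the even term are measured in units of \<open>r\<close>. The last
    pair has \<open>K = 0\<close>, and each step back replaces \<open>K\<close> by
    \<open>1 - 2 * K\<close>.\<close>
  have "\<exists>K. int (u i) = int (u (n + 1)) - r * (1 - 2 * K) \<and> int (u (i + 1)) = int (u (n + 1)) - r * K"
    if "i \<le> n" for i
    using that
  proof (induction rule: inc_induct)
    case base
    show ?case
      by (rule exI[of _ 0]) (simp add: r_def)
  next
    case (step i)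
    then obtain K where K: "int (u (i + 1)) = int (u (n + 1)) - r * (1 - 2 * K)"
      "int (u (i + 2)) = int (u (n + 1)) - r * K"
      by auto
    have "int (u i) + int (u (i + 1)) = 2 * int (u (i + 2))"
      using avg[OF step.hyps(2)] by linarith
    hence "int (u i) = int (u (n + 1)) - r * (1 - 2 * (1 - 2 * K))"
      unfolding K by (simp add: algebra_simps)
    with K(1) show ?case
      by blast
  qed
  from this[of 0] obtain K where
    K: "int (u 0) = int (u (n + 1)) - r * (1 - 2 * K)" "int (u 1) = int (u (n + 1)) - r * K"
    by auto

  have "u i \<le> max (u 0) (u 1) \<and> u (i + 1) \<le> max (u 0) (u 1)" if "i \<le> n" for i
    using that
  proof (induction i)
    case (Suc i)
    thus ?case
      using avg[of i] by simp
  qed simp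
  hence max: "u n \<le> max (u 0) (u 1)" "u (n + 1) \<le> max (u 0) (u 1)"
    by simp_all

  \<comment> \<open>The two closing equations\<close>
  define x y z e where xyze: "x = u 0" "y = u 1" "z = u n" "e = u (n + 1)"
  have xy: "x > 0" "y > 0" "z > 0" "e > 0"
    using pos by (simp_all add: xyze)
  have "odd (z + e)" "odd (e + x)"
    using odd[of 0] odd[of n] even by (auto simp: xyze)
  have "subprime_next z e = x" "subprime_next e x = y"
    using rec[of n] rec[of "n + 1"] per by (simp_all add: xyze eval_nat_numeral)
  have "z + e \<ge> 2" "e + x \<ge> 2"
    using xy by linarith+
  obtain p where p: "z + e = p * x" "prime (z + e) \<and> p = 1 \<or> \<not> prime (z + e) \<and> p \<ge> 3"
    using subprime_next_odd_sum[OF \<open>odd (z + e)\<close> \<open>z + e \<ge> 2\<close>] \<open>subprime_next z e = x\<close> by metis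
  obtain q where q: "e + x = q * y" "prime (e + x) \<and> q = 1 \<or> \<not> prime (e + x) \<and> q \<ge> 3"
    using subprime_next_odd_sum[OF \<open>odd (e + x)\<close> \<open>e + x \<ge> 2\<close>] \<open>subprime_next e x = y\<close> by metis
  have r: "int z = int e - r" and x: "int x = int e - r + 2 * (r * K)" and y: "int y = int e - r * K"
    using K by (simp_all add: xyze r_def algebra_simps)

  have unit: "K = 1 \<and> a = 5 \<or> K = -1 \<and> a = 7" if "K * (6 - a) = 1" for a :: int
    using that by (auto simp: zmult_eq_1_iff)
  consider "p = 1" "prime (z + e)" | "q = 1" "prime (e + x)" "\<not> prime (z + e)"
    | "p \<ge> 3" "q \<ge> 3"
    using p(2) q(2) by auto
  thus False
  proof cases
    case 1
    have "int x = int z + int e"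
      using p(1) 1 by simp
    hence ry: "r * K = int y" and e: "int e = 2 * int y" and x': "int x = 4 * int y - r"
      using r x y by linarith+
    have "int q * int y = int e + int x"
      using q(1) by (metis of_nat_add of_nat_mult)
    \<comment> \<open>The 6 arises from \<open>e + x = 2 * y + (4 * y - r)\<close>, which equals
      \<open>q * y\<close>, with \<open>y = r * K\<close>.\<close>
    hence "r = (6 - int q) * (r * K)"
      unfolding ry using e x' by (simp add: algebra_simps)
    hence "r * (K * (6 - int q)) = r * 1"
      by (simp add: algebra_simps)
    hence "K * (6 - int q) = 1"
      using \<open>r \<noteq> 0\<close> mult_left_cancel by blast
    from unit[OF this] consider "K = 1" "q = 5" | "K = -1" "q = 7"
      by linarith
    thus False
    proof cases
      case 1
      hence "r = int y"
        using ry by simp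
      hence "z + e = 3 * y"
        using r e by linarith
      with \<open>prime (z + e)\<close> have "y = 1"
        using prime_times_eq_1[of 3 y] by simp
      with 1 q show False
        using prime_5_nat by simp
    next
      case 2
      hence "r = - int y"
        using ry by simp
      hence "z + e = 5 * y"
        using r e by linarith
      with \<open>prime (z + e)\<close> have "y = 1"
        using prime_times_eq_1[of 5 y] by simp
      with 2 q show False
        using prime_7_nat by simp
    qed
  next
    case 2
    have "int y = int e + int x"
      using q(1) 2 by simp
    hence rx: "r * K = - int x" and z: "int z = 3 * int x" and e: "int e = 3 * int x + r"
      using r x y by linarith+
    have "int p * int x = int z + int e"
      using p(1) by (metis of_nat_add of_nat_mult)
    \<comment> \<open>Likewise \<open>z + e = 3 * x + (3 * x + r)\<close> equals
      \<open>p * x\<close>, now with \<open>x = - r * K\<close>.\<close>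
    hence "r = (6 - int p) * (r * K)"
      unfolding rx using e z by (simp add: algebra_simps)
    hence "r * (K * (6 - int p)) = r * 1"
      by (simp add: algebra_simps)
    hence "K * (6 - int p) = 1"
      using \<open>r \<noteq> 0\<close> mult_left_cancel by blast
    from unit[OF this] consider "K = 1" "p = 5" | "K = -1" "p = 7"
      by linarith
    thus False
    proof cases
      case 1
      hence "r = - int x"
        using rx by simp
      hence "e + x = 3 * x"
        using e by linarith
      with \<open>prime (e + x)\<close> have "x = 1"
        using prime_times_eq_1[of 3 x] by simp
      with 1 p \<open>\<not> prime (z + e)\<close> show False
        using prime_5_nat by simp
    next
      case 2
      hence "r = int x"
        using rx by simp
      hence "e + x = 5 * x"
        using e by linarith
      with \<open>prime (e + x)\<close> have "x = 1"
        using prime_times_eq_1[of 5 x] by simp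
      with 2 p \<open>\<not> prime (z + e)\<close> show False
        using prime_7_nat by simp
    qed
  next
    case 3
    have "3 * x \<le> z + e" "3 * y \<le> e + x"
      using p(1) q(1) 3 by simp_all
    \<comment> \<open>If \<open>x\<close> is the larger of \<open>x\<close> and \<open>y\<close>,
      then \<open>z + e \<le> 2 * x\<close>; otherwise \<open>e + x \<le> 2 * y\<close>.\<close>
    with max xy show False
      by (auto simp: xyze max_def split: if_splits)
  qed
qed

section \<open>From the cyclic tuple to a periodic sequence\<close>

theorem theorem6:
  shows "\<not> (\<exists>m t. nontrivial_cycle m t \<and> card {i. i < m \<and> even (t ! i)} = 1)"
proof
  assume "\<exists>m t. nontrivial_cycle m t \<and> card {i. i < m \<and> even (t ! i)} = 1"
  then obtain m t where cyc: "nontrivial_cycle m t" and "card {i. i < m \<and> even (t ! i)} = 1"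
    by blast
  then obtain k where k: "{i. i < m \<and> even (t ! i)} = {k}"
    using card_1_singletonE by blast
  hence even_iff: "even (t ! i) \<longleftrightarrow> i = k" if "i < m" for i
    using that by auto
  have pos: "\<And>i. i < m \<Longrightarrow> t ! i > 0" and "m > 0"
    and step: "\<And>i. i < m \<Longrightarrow> t ! ((i + 2) mod m) = subprime_next (t ! i) (t ! ((i + 1) mod m))"
    and "\<exists>i<m. \<exists>j<m. t ! i \<noteq> t ! j"
    using cyc by (auto simp: nontrivial_cycle_def)
  hence "m \<noteq> 1" "k < m"
    using k by auto
  \<comment> \<open>Starting just after the even term puts it at index \<open>m - 1\<close>, at the
    end of the run.\<close>
  define u where "u i = t ! ((k + 1 + i) mod m)" for i
  have rec: "u (i + 2) = subprime_next (u i) (u (i + 1))" for i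
    using step[of "(k + 1 + i) mod m"] \<open>m > 0\<close> by (simp add: u_def mod_simps add_ac)
  have u_pos: "u i > 0" for i
    using pos \<open>m > 0\<close> by (simp add: u_def)
  have per: "u (i + m) = u i" for i
    using mod_add_self2[of "k + 1 + i" m] by (simp only: u_def add.assoc)
  have u_even: "even (u (m - 1))"
    using \<open>k < m\<close> even_iff[of k] by (simp add: u_def)
  have u_odd: "odd (u i)" if "i < m - 1" for i
  proof -
    have "(k + 1 + i) mod m \<noteq> k"
    proof
      assume "(k + 1 + i) mod m = k"
      hence "(k + (1 + i)) mod m = (k + 0) mod m"
        using \<open>k < m\<close> by (simp add: add.assoc)
      hence "(1 + i) mod m = 0 mod m"
        by (metis add_diff_cancel_left' add.right_neutral mod_eq_dvd_iff_nat le_add1 mod_0 dvd_imp_mod_0)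
      thus False
        using that by simp
    qed
    thus ?thesis
      using even_iff[of "(k + 1 + i) mod m"] \<open>m > 0\<close> by (simp add: u_def)
  qed
  \<comment> \<open>With a single odd term nothing is averaged. Here the odd sum
    \<open>u 1 + u 2\<close> would be a multiple of the even term \<open>u 1\<close>, which follows
    it.\<close>
  have "m \<noteq> 2"
  proof
    assume "m = 2"
    have "u 2 = u 0"
      using per[of 0] by (simp only: \<open>m = 2\<close> add_0)
    hence "odd (u 1 + u 2)"
      using u_even u_odd[of 0] \<open>m = 2\<close> by simp
    moreover have "u 1 + u 2 \<ge> 2"
      using u_pos[of 1] u_pos[of 2] by linarith
    ultimately obtain p where "u 1 + u 2 = p * subprime_next (u 1) (u 2)"
      using subprime_next_odd_sum by metis
    hence "u 1 + u 2 = p * u 1"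
      using rec[of 1] per[of 1] \<open>m = 2\<close> by (simp add: eval_nat_numeral)
    moreover have "even (p * u 1)"
      using u_even \<open>m = 2\<close> by simp
    ultimately show False
      using \<open>odd (u 1 + u 2)\<close> by metis
  qed
  define n where "n = m - 2"
  hence n: "m = n + 2" "n \<ge> 1"
    using \<open>m > 0\<close> \<open>m \<noteq> 1\<close> \<open>m \<noteq> 2\<close> by simp_all
  show False
  proof (rule no_single_run[OF n(2) rec u_pos])
    show "odd (u i)" if "i \<le> n" for i
      using u_odd that n by simp
    show "even (u (n + 1))"
      using u_even n by simp
    show "u (n + 2) = u 0" "u (n + 3) = u 1"
      using per[of 0] per[of 1] n by (simp_all add: eval_nat_numeral)
  qed
qed

end
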